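(* For any integer $k\ge 2$, we have $\mathrm{dmg}(M_k)=2\binom{2k-1}{k-1}$.
   Context: For a set $S$, $\binom{S}{k}$ denotes the family of all $k$-element subsets of $S$, and $[n]=\{1,\dots,n\}$. The middle graph $M_k$ is the bipartite graph with parts $\binom{[2k+1]}{k}$ and $\binom{[2k+1]}{k+1}$, in which $F\in\binom{[2k+1]}{k}$ and $H\in\binom{[2k+1]}{k+1}$ are joined by an edge if and only if $F\subseteq H$. Damage number. One cop and one robber play on a graph $G$ with perfect information. First the cop chooses a starting vertex, then the robber chooses a starting vertex (this placement is round $0$). Each subsequent round consists of a move of the cop followed by a move of the robber; in a move a player either stays at the current vertex or moves to a neighboring vertex. If the cop ever occupies the same vertex as the robber, the robber is captured and the game ends. If a vertex $v$ is occupied by the robber at the end of a round and the robber is not caught in the following round, then $v$ becomes damaged and stays damaged for the rest of the game. The cop wants to minimize, and the robber to maximize, the number of damaged vertices. The damage number $\mathrm{dmg}(G)$ is the number of damaged vertices when both play optimally, i.e. the maximum number of vertices the robber can guarantee to damage no matter the strategy of the cop. *)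

theory Defs
  imports "Graph_Theory.Graph_Theory"
begin

text \<open>Graphs are values of type \<^typ>\<open>'v pair_pre_digraph\<close>; a finite simple undirected graph is one
  satisfying \<^const>\<open>pair_graph\<close>, so each edge is represented by both of its orientations.\<close>

definition middle_graph :: "nat \<Rightarrow> nat set pair_pre_digraph" where
  "middle_graph k =
    (let A = {F. F \<subseteq> {1..2*k+1} \<and> card F = k};
         B = {H. H \<subseteq> {1..2*k+1} \<and> card H = k + 1};
         E = {(F, H). F \<in> A \<and> H \<in> B \<and> F \<subseteq> H}
     in \<lparr> pverts = A \<union> B, parcs = E \<union> E\<inverse> \<rparr>)"

lemma pair_graph_middle_graph: "pair_graph (middle_graph k)"
proof -
  define A where "A = {F::nat set. F \<subseteq> {1..2*k+1} \<and> card F = k}"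
  define B where "B = {H::nat set. H \<subseteq> {1..2*k+1} \<and> card H = k + 1}"
  define E where "E = {(F, H). F \<in> A \<and> H \<in> B \<and> F \<subseteq> H}"
  have M: "middle_graph k = \<lparr> pverts = A \<union> B, parcs = E \<union> E\<inverse> \<rparr>"
    unfolding middle_graph_def Let_def A_def B_def E_def by (rule refl)
  have "A \<union> B \<subseteq> Pow {1..2*k+1}" unfolding A_def B_def by blast
  then have fin: "finite (A \<union> B)" by (rule finite_subset) simp
  have sub: "E \<union> E\<inverse> \<subseteq> (A \<union> B) \<times> (A \<union> B)" unfolding E_def by blast
  then have fa: "finite (E \<union> E\<inverse>)" using fin by (meson finite_SigmaI finite_subset)
  have sy: "sym (E \<union> E\<inverse>)" unfolding sym_def by blast
  have "A \<inter> B = {}" unfolding A_def B_def by auto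
  then have lf: "fst e \<noteq> snd e" if "e \<in> E \<union> E\<inverse>" for e
    using that unfolding E_def by auto
  show ?thesis
    unfolding M
  proof (unfold_locales, unfold symmetric_def with_proj_simps pair_pre_digraph.simps)
    show "fst e \<in> A \<union> B" "snd e \<in> A \<union> B" if "e \<in> E \<union> E\<inverse>" for e
      using subsetD[OF sub that] by (simp_all only: mem_Times_iff)
  qed (fact fin fa sy lf)+
qed

definition closed_nbhd :: "'v pair_pre_digraph \<Rightarrow> 'v \<Rightarrow> 'v set" where
  "closed_nbhd G v = insert v {w. (v, w) \<in> parcs G}"

text \<open>A history lists the pairs (cop, robber) of positions at the ends of the rounds
  \<open>0, 1, \<dots>\<close> completed so far; the empty history precedes the placement round.
  The robber moves second in each round, so a robber strategy also sees the current move of the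
  cop. Staying put is always allowed, hence demanding legal moves on every history, even one that
  cannot arise, excludes no behaviour in actual play.\<close>

type_synonym 'v cop_strat = "('v \<times> 'v) list \<Rightarrow> 'v"
type_synonym 'v robber_strat = "('v \<times> 'v) list \<Rightarrow> 'v \<Rightarrow> 'v"

definition cop_strategy :: "'v pair_pre_digraph \<Rightarrow> 'v cop_strat \<Rightarrow> bool" where
  "cop_strategy G \<sigma> \<longleftrightarrow>
     \<sigma> [] \<in> pverts G \<and> (\<forall>h. h \<noteq> [] \<longrightarrow> \<sigma> h \<in> closed_nbhd G (fst (last h)))"

definition robber_strategy :: "'v pair_pre_digraph \<Rightarrow> 'v robber_strat \<Rightarrow> bool" where
  "robber_strategy G \<rho> \<longleftrightarrow>
     (\<forall>c. \<rho> [] c \<in> pverts G) \<and> (\<forall>h c. h \<noteq> [] \<longrightarrow> \<rho> h c \<in> closed_nbhd G (snd (last h)))"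

primrec history :: "'v cop_strat \<Rightarrow> 'v robber_strat \<Rightarrow> nat \<Rightarrow> ('v \<times> 'v) list" where
  "history \<sigma> \<rho> 0 = []"
| "history \<sigma> \<rho> (Suc n) =
     (let h = history \<sigma> \<rho> n; c = \<sigma> h; r = \<rho> h c in h @ [(c, r)])"

definition play :: "'v cop_strat \<Rightarrow> 'v robber_strat \<Rightarrow> nat \<Rightarrow> 'v \<times> 'v" where
  "play \<sigma> \<rho> i = last (history \<sigma> \<rho> (Suc i))"

text \<open>In round \<open>i\<close> the robber is caught either by his own move onto the cop's vertex, or by the
  preceding move of the cop onto the vertex where the robber ended round \<open>i - 1\<close>.\<close>

definition caught :: "(nat \<Rightarrow> 'v \<times> 'v) \<Rightarrow> nat \<Rightarrow> bool" where
  "caught p i \<longleftrightarrow> fst (p i) = snd (p i) \<or> (\<exists>j. i = Suc j \<and> fst (p i) = snd (p j))"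

text \<open>The sequence of positions formally continues after a capture; the game being over, nothing
  counts as damaged from then on.\<close>

definition damaged :: "(nat \<Rightarrow> 'v \<times> 'v) \<Rightarrow> 'v set" where
  "damaged p = {snd (p i) | i. \<forall>j \<le> Suc i. \<not> caught p j}"

definition dmg :: "'v pair_pre_digraph \<Rightarrow> nat" where
  "dmg G = Max {d. \<exists>\<rho>. robber_strategy G \<rho> \<and>
                     (\<forall>\<sigma>. cop_strategy G \<sigma> \<longrightarrow> d \<le> card (damaged (play \<sigma> \<rho>)))}"

text \<open>The set in the definition of \<^const>\<open>dmg\<close> is finite and nonempty, so that its maximum
  is meaningful.\<close>

lemma history_in_verts:
  assumes "pair_graph G" "cop_strategy G \<sigma>" "robber_strategy G \<rho>"
  shows "set (history \<sigma> \<rho> n) \<subseteq> pverts G \<times> pverts G"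
proof (induction n)
  case (Suc n)
  interpret pair_graph G by fact
  have nb: "closed_nbhd G v \<subseteq> pverts G" if "v \<in> pverts G" for v
    using that by (auto simp: closed_nbhd_def dest: in_arcsD2)
  show ?case
  proof (cases "history \<sigma> \<rho> n = []")
    case True
    then show ?thesis using assms by (auto simp: Let_def cop_strategy_def robber_strategy_def)
  next
    case False
    then have "last (history \<sigma> \<rho> n) \<in> pverts G \<times> pverts G"
      using Suc.IH last_in_set by blast
    then have "fst (last (history \<sigma> \<rho> n)) \<in> pverts G" "snd (last (history \<sigma> \<rho> n)) \<in> pverts G"
      by auto
    then have "\<sigma> (history \<sigma> \<rho> n) \<in> pverts G"
      and "\<rho> (history \<sigma> \<rho> n) (\<sigma> (history \<sigma> \<rho> n)) \<in> pverts G"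
      using False nb assms(2,3) unfolding cop_strategy_def robber_strategy_def by blast+
    then show ?thesis using Suc.IH by (simp add: Let_def)
  qed
qed simp

lemma dmg_set_wf:
  assumes G: "pair_graph G" and ne: "pverts G \<noteq> {}"
  defines "D \<equiv> {d. \<exists>\<rho>. robber_strategy G \<rho> \<and>
                     (\<forall>\<sigma>. cop_strategy G \<sigma> \<longrightarrow> d \<le> card (damaged (play \<sigma> \<rho>)))}"
  shows "finite D" "D \<noteq> {}"
proof -
  obtain v where v: "v \<in> pverts G" using ne by auto
  define \<sigma> :: "'a cop_strat" where "\<sigma> = (\<lambda>h. if h = [] then v else fst (last h))"
  define \<rho> :: "'a robber_strat" where "\<rho> = (\<lambda>h c. if h = [] then v else snd (last h))"
  have s: "cop_strategy G \<sigma>" "robber_strategy G \<rho>"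
    using v by (auto simp: \<sigma>_def \<rho>_def cop_strategy_def robber_strategy_def closed_nbhd_def)
  then have "0 \<in> D" by (auto simp: D_def)
  then show "D \<noteq> {}" by blast
  have fin: "finite (pverts G)"
    using G by (simp add: pair_graph_def pair_digraph_def pair_fin_digraph_def
        pair_fin_digraph_axioms_def)
  have "d \<le> card (pverts G)" if d: "d \<in> D" for d
  proof -
    obtain \<rho>' where r: "robber_strategy G \<rho>'" and le: "d \<le> card (damaged (play \<sigma> \<rho>'))"
      using d s(1) by (auto simp: D_def)
    have "play \<sigma> \<rho>' i \<in> pverts G \<times> pverts G" for i
    proof -
      have "play \<sigma> \<rho>' i \<in> set (history \<sigma> \<rho>' (Suc i))"
        unfolding play_def by (rule last_in_set) (simp add: Let_def)
      then show ?thesis using history_in_verts[OF G s(1) r] by blast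
    qed
    then have "damaged (play \<sigma> \<rho>') \<subseteq> pverts G"
      by (fastforce simp: damaged_def mem_Times_iff)
    then show ?thesis using le card_mono[OF fin] le_trans by blast
  qed
  then show "finite D" using finite_nat_set_iff_bounded_le by blast
qed

end

theory Submission
  imports Defs
begin

text \<open>The cop confines the robber to the vertices that contain some fixed element \<open>a\<close> and avoid some
  fixed element \<open>b\<close>; these form a copy of \<open>middle_graph (k - 1)\<close> and there are
  \<open>2 * ((2 * k - 1) choose (k - 1))\<close> of them.  To this end the cop with set \<open>c\<close> first matches the size of
  the robber's set \<open>r\<close> and from then on shadows him: he moves only when the robber moves, making the same
  change where possible (\<open>cop_shadows\<close>).  The differences \<open>r - c\<close> and \<open>c - r\<close> after his moves then only
  shrink, and as long as the robber is free both are nonempty.  Hence an element \<open>a\<close> of the one and an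
  element \<open>b\<close> of the other at the last time of damage have been there all the time (\<open>cop_protects\<close>).

  The robber, on the other hand, always steps to a neighbour that the cop does not reach in his next
  move.  As the graph has no cycles of length 3 or 4, the cop excludes at most one neighbour at a time,
  so the robber is never caught.  If among the possible steps he prefers the vertices he has visited
  least, then the set \<open>T\<close> of vertices that he visits infinitely often has the property that each of
  its members has at most one neighbour outside \<open>T\<close> (\<open>robber_fair_damage\<close>).  So \<open>T\<close> induces a nonempty
  subgraph of minimum degree at least \<open>k\<close>, and such a subgraph is at least as large as
  \<open>middle_graph (k - 1)\<close>.  This last fact is a special case of a bound on two families of sets of which
  the first has large up-degrees into the second and the second large down-degrees into the first
  (\<open>card_families_ge_binomial\<close>).\<close>

section \<open>Positions along a play\<close>

lemma history_play: "history \<sigma> \<rho> n = map (play \<sigma> \<rho>) [0..<n]"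
  by (induction n) (simp_all add: play_def Let_def)

lemma play_step:
  "fst (play \<sigma> \<rho> n) = \<sigma> (history \<sigma> \<rho> n)"
  "snd (play \<sigma> \<rho> n) = \<rho> (history \<sigma> \<rho> n) (fst (play \<sigma> \<rho> n))"
  by (simp_all add: play_def Let_def)

lemma last_history: "last (history \<sigma> \<rho> (Suc n)) = play \<sigma> \<rho> n"
  by (simp add: play_def)

lemma history_Suc_not_Nil: "history \<sigma> \<rho> (Suc n) \<noteq> []"
  by (simp add: Let_def)

lemma play_in_verts:
  assumes "pair_graph G" "cop_strategy G \<sigma>" "robber_strategy G \<rho>"
  shows "fst (play \<sigma> \<rho> n) \<in> pverts G" "snd (play \<sigma> \<rho> n) \<in> pverts G"
proof -
  have "play \<sigma> \<rho> n \<in> set (history \<sigma> \<rho> (Suc n))"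
    using last_in_set[OF history_Suc_not_Nil] by (metis last_history)
  then have "play \<sigma> \<rho> n \<in> pverts G \<times> pverts G"
    using history_in_verts[OF assms] by blast
  then show "fst (play \<sigma> \<rho> n) \<in> pverts G" "snd (play \<sigma> \<rho> n) \<in> pverts G"
    by (simp_all add: mem_Times_iff)
qed

lemma cop_moves:
  assumes "cop_strategy G \<sigma>"
  shows "fst (play \<sigma> \<rho> (Suc n)) \<in> closed_nbhd G (fst (play \<sigma> \<rho> n))"
  using assms history_Suc_not_Nil[of \<sigma> \<rho> n] last_history[of \<sigma> \<rho> n]
  unfolding cop_strategy_def play_step(1)[of \<sigma> \<rho> "Suc n"] by metis

lemma robber_moves:
  assumes "robber_strategy G \<rho>"
  shows "snd (play \<sigma> \<rho> (Suc n)) \<in> closed_nbhd G (snd (play \<sigma> \<rho> n))"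
  using assms history_Suc_not_Nil[of \<sigma> \<rho> n] last_history[of \<sigma> \<rho> n]
  unfolding robber_strategy_def play_step(2)[of \<sigma> \<rho> "Suc n"] by metis

section \<open>A robber who prefers rarely visited vertices\<close>

definition visits :: "(nat \<Rightarrow> 'v) \<Rightarrow> nat \<Rightarrow> 'v \<Rightarrow> nat" where
  "visits r n u = card {i. i < n \<and> r i = u}"

text \<open>Think of \<open>N n\<close> as the vertices on offer for the step from \<open>r n\<close> to \<open>r (Suc n)\<close>.  The visit count of a
  vertex \<open>u\<close> that is visited only finitely often is bounded.  From some time on, all vertices
  visited are visited infinitely often and have counts above this bound.  If \<open>u\<close> were on offer after
  that time, it would have been preferred to the vertex actually visited.\<close>

lemma least_visited_fair:
  assumes V: "finite V" "\<And>n. r n \<in> V"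
    and least: "\<And>n u. u \<in> N n \<Longrightarrow> visits r n (r (Suc n)) \<le> visits r n u"
    and u: "finite {n. r n = u}"
  shows "finite {n. u \<in> N n}"
proof -
  define B where "B = card {n. r n = u}"
  have B: "visits r n u \<le> B" for n
    unfolding visits_def B_def by (rule card_mono[OF u]) auto
  have "\<forall>\<^sub>F n in sequentially. r n = w \<longrightarrow> B < visits r (n - 1) w" for w
  proof (cases "finite {n. r n = w}")
    case True
    then obtain m where "\<forall>n\<in>{n. r n = w}. n < m"
      using finite_nat_set_iff_bounded by blast
    then show ?thesis
      unfolding eventually_sequentially by (intro exI[of _ m]) auto
  next
    case False
    then obtain X where X: "finite X" "card X = Suc B" "X \<subseteq> {n. r n = w}"
      using infinite_arbitrarily_large by blast
    obtain m where m: "\<forall>n\<in>X. n < m"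
      using X(1) finite_nat_set_iff_bounded by blast
    have "B < visits r (n - 1) w" if "n \<ge> Suc m" for n
    proof -
      have "card X \<le> visits r (n - 1) w"
        unfolding visits_def using X(3) m that by (intro card_mono) auto
      then show ?thesis using X(2) by simp
    qed
    then show ?thesis
      unfolding eventually_sequentially by blast
  qed
  \<comment> \<open>Only finitely many vertices compete, so one threshold in time serves them all.\<close>
  then have "\<forall>\<^sub>F n in sequentially. \<forall>w\<in>V. r n = w \<longrightarrow> B < visits r (n - 1) w"
    by (intro eventually_ball_finite[OF V(1)] ballI)
  then obtain m where "\<forall>n\<ge>m. \<forall>w\<in>V. r n = w \<longrightarrow> B < visits r (n - 1) w"
    unfolding eventually_sequentially by (rule exE)
  then have m: "B < visits r (n - 1) (r n)" if "n \<ge> m" for n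
    using V(2)[of n] that by simp
  have "n < m" if "u \<in> N n" for n
  proof (rule ccontr)
    assume "\<not> n < m"
    then have "B < visits r n (r (Suc n))" using m[of "Suc n"] by simp
    then show False using least[OF that] B[of n] by linarith
  qed
  then show ?thesis using finite_nat_set_iff_bounded by blast
qed

text \<open>A robber who always steps outside the closed neighbourhood of the cop is never caught, so
  that he damages every vertex he visits.  If the cop can spoil at most one of his possible steps, he
  can do so forever, and by choosing a least visited one among the unspoiled steps he makes
  sure that two neighbours of a vertex visited infinitely often are not both neglected: at each
  visit one of them is on offer.\<close>

lemma robber_fair_damage:
  assumes G: "pair_graph G" and ne: "pverts G \<noteq> {}"
    and far: "\<And>c. c \<in> pverts G \<Longrightarrow> \<exists>v\<in>pverts G. v \<notin> closed_nbhd G c"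
    and deg: "\<And>v. v \<in> pverts G \<Longrightarrow> \<exists>u w. u \<noteq> w \<and> (v, u) \<in> parcs G \<and> (v, w) \<in> parcs G"
    and spoil: "\<And>c v u w. \<lbrakk>c \<in> pverts G; v \<in> pverts G; v \<noteq> c; (v, u) \<in> parcs G; (v, w) \<in> parcs G;
           u \<in> closed_nbhd G c; w \<in> closed_nbhd G c\<rbrakk> \<Longrightarrow> u = w"
  obtains \<rho> where "robber_strategy G \<rho>"
    and "\<And>\<sigma>. cop_strategy G \<sigma> \<Longrightarrow> \<exists>T \<subseteq> damaged (play \<sigma> \<rho>). T \<noteq> {} \<and> T \<subseteq> pverts G \<and>
           (\<forall>v\<in>T. \<forall>u w. (v, u) \<in> parcs G \<longrightarrow> (v, w) \<in> parcs G \<longrightarrow> u \<notin> T \<longrightarrow> w \<notin> T \<longrightarrow> u = w)"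
proof -
  interpret pair_graph G by (rule G)
  define safe where "safe v c = {u. (v, u) \<in> parcs G \<and> u \<notin> closed_nbhd G c}" for v c
  define \<rho> where "\<rho> h c =
    (if h = [] then SOME v. v \<in> pverts G \<and> (c \<in> pverts G \<longrightarrow> v \<notin> closed_nbhd G c)
     else if safe (snd (last h)) c = {} then snd (last h)
     else arg_min (visits (\<lambda>i. snd (h ! i)) (length h)) (\<lambda>u. u \<in> safe (snd (last h)) c))"
    for h :: "('a \<times> 'a) list" and c
  have start: "\<rho> [] c \<in> pverts G \<and> (c \<in> pverts G \<longrightarrow> \<rho> [] c \<notin> closed_nbhd G c)" for c
  proof -
    have "\<exists>v. v \<in> pverts G \<and> (c \<in> pverts G \<longrightarrow> v \<notin> closed_nbhd G c)"
      using far ne by blast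
    from someI_ex[OF this] show ?thesis unfolding \<rho>_def if_P[OF refl] .
  qed
  have step: "\<rho> h c \<in> safe (snd (last h)) c \<and>
      (\<forall>u\<in>safe (snd (last h)) c. visits (\<lambda>i. snd (h ! i)) (length h) (\<rho> h c)
         \<le> visits (\<lambda>i. snd (h ! i)) (length h) u)"
    if h: "h \<noteq> []" "safe (snd (last h)) c \<noteq> {}" for h c
  proof -
    obtain u where u: "u \<in> safe (snd (last h)) c" using h(2) by blast
    have "\<rho> h c = arg_min (visits (\<lambda>i. snd (h ! i)) (length h)) (\<lambda>u. u \<in> safe (snd (last h)) c)"
      using h by (simp only: \<rho>_def if_False)
    then show ?thesis
      using arg_min_nat_lemma[of "\<lambda>u. u \<in> safe (snd (last h)) c" u
          "visits (\<lambda>i. snd (h ! i)) (length h)"] u by metis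
  qed
  have rob: "robber_strategy G \<rho>"
    unfolding robber_strategy_def
  proof (intro conjI allI impI)
    fix h :: "('a \<times> 'a) list" and c assume h: "h \<noteq> []"
    show "\<rho> h c \<in> closed_nbhd G (snd (last h))"
    proof (cases "safe (snd (last h)) c = {}")
      case True
      then show ?thesis using h by (simp add: \<rho>_def closed_nbhd_def)
    next
      case False
      then show ?thesis using step[OF h False] by (simp add: safe_def closed_nbhd_def)
    qed
  qed (use start in blast)
  have "\<exists>T \<subseteq> damaged (play \<sigma> \<rho>). T \<noteq> {} \<and> T \<subseteq> pverts G \<and>
      (\<forall>v\<in>T. \<forall>u w. (v, u) \<in> parcs G \<longrightarrow> (v, w) \<in> parcs G \<longrightarrow> u \<notin> T \<longrightarrow> w \<notin> T \<longrightarrow> u = w)"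
    if cop: "cop_strategy G \<sigma>" for \<sigma>
  proof -
    let ?p = "play \<sigma> \<rho>"
    define r where "r n = snd (?p n)" for n
    define c where "c n = fst (?p n)" for n
    define N where "N n = safe (r n) (c (Suc n))" for n
    have V: "c n \<in> pverts G" "r n \<in> pverts G" for n
      using play_in_verts[OF G cop rob] by (simp_all add: r_def c_def)
    have cm: "c (Suc n) \<in> closed_nbhd G (c n)" for n
      using cop_moves[OF cop] by (simp add: c_def)
    have next_step: "r (Suc n) \<in> N n \<and> (\<forall>u\<in>N n. visits r n (r (Suc n)) \<le> visits r n u)"
      if out: "r n \<notin> closed_nbhd G (c n)" for n
    proof -
      obtain u w where uw: "u \<noteq> w" "(r n, u) \<in> parcs G" "(r n, w) \<in> parcs G"
        using deg[OF V(2)] by blast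
      have "r n \<noteq> c (Suc n)" using out cm by metis
      then have N: "N n \<noteq> {}"
        using spoil[OF V(1) V(2) _ uw(2,3)] uw unfolding N_def safe_def by blast
      let ?h = "history \<sigma> \<rho> (Suc n)"
      have eq: "\<rho> ?h (c (Suc n)) = r (Suc n)" "snd (last ?h) = r n"
        by (simp_all only: r_def c_def play_step(2)[of \<sigma> \<rho> "Suc n"] last_history)
      have vis: "visits (\<lambda>i. snd (?h ! i)) (length ?h) = visits r (Suc n)"
        unfolding visits_def history_play r_def
        by (intro ext arg_cong[where f = card]) (auto simp del: upt_Suc)
      have 1: "r (Suc n) \<in> N n"
        and 2: "\<And>u. u \<in> N n \<Longrightarrow> visits r (Suc n) (r (Suc n)) \<le> visits r (Suc n) u"
        using step[OF history_Suc_not_Nil, of \<sigma> \<rho> n "c (Suc n)"] N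
        unfolding eq vis N_def by auto
      \<comment> \<open>The robber's counts include the current visit to \<open>r n\<close>, which affects no candidate, since
        a vertex is not its own neighbour.\<close>
      have "visits r (Suc n) u = visits r n u" if "u \<in> N n" for u
      proof -
        have "u \<noteq> r n" 
          using that pair_no_loops[of "(u, u)"]
          by (auto simp: N_def safe_def)
        then have "{i. i < Suc n \<and> r i = u} = {i. i < n \<and> r i = u}" using less_Suc_eq by auto
        then show ?thesis by (simp add: visits_def)
      qed
      then show ?thesis using 1 2 by metis
    qed
    have out: "r n \<notin> closed_nbhd G (c n)" for n
    proof (induction n)
      case 0
      then show ?case using start V(1)[of 0] unfolding r_def c_def play_step(2)[of _ _ 0] by simp
    next
      case (Suc n)
      then show ?case using next_step[OF Suc] by (simp add: N_def safe_def)
    qed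
    have "\<not> caught ?p n" for n
      using out cm unfolding caught_def r_def c_def
      by (metis closed_nbhd_def insertI1)
    then have dam: "damaged ?p = range r" by (auto simp: damaged_def r_def)
    define T where "T = {v. infinite {n. r n = v}}"
    have fin: "finite (pverts G)" by (rule finite_verts)
    have "T \<subseteq> range r" unfolding T_def by (auto dest: infinite_imp_nonempty)
    moreover have "T \<noteq> {}"
    proof -
      have "finite (range r)" using V(2) fin by (meson finite_subset image_subsetI)
      then obtain v where "infinite {n \<in> UNIV. r n = v}"
        using pigeonhole_infinite[of UNIV r] by auto
      then show ?thesis unfolding T_def by auto
    qed
    moreover have "u = w"
      if v: "v \<in> T" and arcs: "(v, u) \<in> parcs G" "(v, w) \<in> parcs G" and uw: "u \<notin> T" "w \<notin> T" for v u w
    proof (rule ccontr)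
      assume "u \<noteq> w"
      have *: "finite {n. x \<in> N n}" if "x \<notin> T" for x
        by (rule least_visited_fair[where V = "pverts G" and r = r])
          (use fin V(2) next_step out that in \<open>auto simp: T_def\<close>)
      have "n \<in> {n. u \<in> N n} \<union> {n. w \<in> N n}" if "r n = v" for n
      proof -
        have "r n \<noteq> c (Suc n)" using out cm by metis
        then show ?thesis
          using spoil[OF V(1) V(2), of n "Suc n" u w] arcs \<open>u \<noteq> w\<close> that
          unfolding N_def safe_def by blast
      qed
      then have "finite {n. r n = v}"
        using finite_subset[of "{n. r n = v}" "{n. u \<in> N n} \<union> {n. w \<in> N n}"] * uw by blast
      then show False using v by (simp add: T_def)
    qed
    moreover have "range r \<subseteq> pverts G" using V(2) by blast
    ultimately show ?thesis
      unfolding dam by (intro exI[of _ T] conjI ballI allI impI) (assumption | rule subset_trans)+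
  qed
  then show thesis by (rule that[OF rob])
qed

section \<open>Families with large up- and down-degrees\<close>

text \<open>The extremal example consists of the subsets of sizes \<open>q - 1\<close> and \<open>q\<close> of a set of size
  \<open>p + q - 1\<close>.  For an element \<open>x\<close> that lies in some but not all members of \<open>A\<close>, split both
  families according to membership of \<open>x\<close>.  Among the sets that contain \<open>x\<close>, only down-degrees drop,
  by at most one, since only the removal of \<open>x\<close> leaves that part; among those that avoid \<open>x\<close>,
  only up-degrees drop, by at most one.  The two bounds obtained by induction add up by Pascal's
  rule.  Such an \<open>x\<close> exists if \<open>q \<ge> 2\<close>: two sets \<open>b - {x}\<close> and \<open>b - {y}\<close> in \<open>A\<close> differ in \<open>x\<close>.\<close>

lemma card_families_ge_binomial:
  fixes A B :: "'a set set"
  assumes "finite A" "finite B" "A \<noteq> {}" "q \<ge> 1"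
    and "\<And>a. a \<in> A \<Longrightarrow> p \<le> card {x. x \<notin> a \<and> insert x a \<in> B}"
    and "\<And>b. b \<in> B \<Longrightarrow> q \<le> card {x. x \<in> b \<and> b - {x} \<in> A}"
  shows "(p + q - 1) choose (q - 1) \<le> card A \<and> (p + q - 1) choose q \<le> card B"
  using assms
proof (induction "p + q" arbitrary: p q A B rule: less_induct)
  case less
  note up = less.prems(5) and down = less.prems(6)
  have A1: "card A \<ge> 1" using less.prems(1,3) by (simp add: Suc_le_eq card_gt_0_iff)
  consider "p = 0" | "q = 1" | "p \<ge> 1" "q \<ge> 2" using less.prems(4) by linarith
  then show ?case
  proof cases
    case 1
    then show ?thesis using A1 less.prems(4) by (simp add: binomial_eq_0)
  next
    case 2
    obtain a where a: "a \<in> A" using less.prems(3) by blast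
    have "card {x. x \<notin> a \<and> insert x a \<in> B} \<le> card B"
      by (rule card_inj_on_le[of "\<lambda>x. insert x a"]) (use less.prems(2) in \<open>auto simp: inj_on_def\<close>)
    then show ?thesis using up[OF a] A1 2 by simp
  next
    case 3
    obtain x a1 a2 where x: "a1 \<in> A" "a2 \<in> A" "x \<in> a1" "x \<notin> a2"
    proof -
      obtain a where a: "a \<in> A" using less.prems(3) by blast
      have "{x. x \<notin> a \<and> insert x a \<in> B} \<noteq> {}" using up[OF a] 3(1) by (metis card.empty not_one_le_zero le_trans)
      then obtain b where b: "b \<in> B" by blast
      have "2 \<le> card {x. x \<in> b \<and> b - {x} \<in> A}" using down[OF b] 3(2) by linarith
      then obtain x y where "x \<noteq> y" "x \<in> b" "y \<in> b" "b - {x} \<in> A" "b - {y} \<in> A"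
        by (auto simp: numeral_2_eq_2 card_le_Suc_iff)
      then show thesis using that[of "b - {y}" "b - {x}" x] by blast
    qed
    let ?A1 = "{a \<in> A. x \<in> a}" and ?B1 = "{b \<in> B. x \<in> b}"
    let ?A0 = "{a \<in> A. x \<notin> a}" and ?B0 = "{b \<in> B. x \<notin> b}"
    have "(p + (q - 1) - 1) choose (q - 1 - 1) \<le> card ?A1 \<and> (p + (q - 1) - 1) choose (q - 1) \<le> card ?B1"
    proof (rule less.hyps)
      fix a assume a: "a \<in> ?A1"
      then have "{y. y \<notin> a \<and> insert y a \<in> ?B1} = {y. y \<notin> a \<and> insert y a \<in> B}" by auto
      then show "p \<le> card {y. y \<notin> a \<and> insert y a \<in> ?B1}" using up a by simp
    next
      fix b assume b: "b \<in> ?B1"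
      have "{y. y \<in> b \<and> b - {y} \<in> ?A1} = {y. y \<in> b \<and> b - {y} \<in> A} - {x}" using b by auto
      then show "q - 1 \<le> card {y. y \<in> b \<and> b - {y} \<in> ?A1}"
        using down[of b] b diff_card_le_card_Diff[of "{x}" "{y. y \<in> b \<and> b - {y} \<in> A}"] by force
    qed (use less.prems 3 x in auto)
    moreover have "(p - 1 + q - 1) choose (q - 1) \<le> card ?A0 \<and> (p - 1 + q - 1) choose q \<le> card ?B0"
    proof (rule less.hyps)
      fix a assume a: "a \<in> ?A0"
      have "{y. y \<notin> a \<and> insert y a \<in> ?B0} = {y. y \<notin> a \<and> insert y a \<in> B} - {x}" using a by auto
      then show "p - 1 \<le> card {y. y \<notin> a \<and> insert y a \<in> ?B0}"
        using up[of a] a diff_card_le_card_Diff[of "{x}" "{y. y \<notin> a \<and> insert y a \<in> B}"] by force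
    next
      fix b assume b: "b \<in> ?B0"
      then have "{y. y \<in> b \<and> b - {y} \<in> ?A0} = {y. y \<in> b \<and> b - {y} \<in> A}" by auto
      then show "q \<le> card {y. y \<in> b \<and> b - {y} \<in> ?A0}" using down b by simp
    qed (use less.prems 3 x in auto)
    moreover have "card A = card ?A1 + card ?A0" "card B = card ?B1 + card ?B0"
      by (subst card_Un_disjoint[symmetric]; use less.prems in \<open>auto intro!: arg_cong[where f = card]\<close>)+
    moreover obtain p' q' where "p = Suc p'" "q = Suc (Suc q')"
      using 3 by (metis Suc_le_D One_nat_def numeral_2_eq_2 Suc_le_mono)
    ultimately show ?thesis by simp
  qed
qed

section \<open>The middle graph\<close>

lemma pverts_middle_graph:
  "v \<in> pverts (middle_graph k) \<longleftrightarrow> v \<subseteq> {1..2*k+1} \<and> (card v = k \<or> card v = Suc k)"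
  by (auto simp: middle_graph_def Let_def)

lemma parcs_middle_graph:
  "(v, w) \<in> parcs (middle_graph k) \<longleftrightarrow> v \<in> pverts (middle_graph k) \<and> w \<in> pverts (middle_graph k) \<and>
     (v \<subseteq> w \<and> card v = k \<and> card w = Suc k \<or> w \<subseteq> v \<and> card w = k \<and> card v = Suc k)"
  unfolding pverts_middle_graph by (simp add: middle_graph_def Let_def) blast

lemma finite_pverts_middle_graph: "finite (pverts (middle_graph k))"
  by (rule finite_subset[of _ "Pow {1..2*k+1}"]) (use pverts_middle_graph in blast, simp)

lemma finite_vert: "v \<in> pverts (middle_graph k) \<Longrightarrow> finite v"
  unfolding pverts_middle_graph by (meson finite_atLeastAtMost finite_subset)

lemma arc_insert:
  assumes "v \<in> pverts (middle_graph k)" "card v = k" "x \<in> {1..2*k+1} - v"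
  shows "(v, insert x v) \<in> parcs (middle_graph k)"
  using assms finite_vert[OF assms(1)] by (auto simp: parcs_middle_graph pverts_middle_graph)

lemma arc_remove:
  assumes "v \<in> pverts (middle_graph k)" "card v = Suc k" "x \<in> v"
  shows "(v, v - {x}) \<in> parcs (middle_graph k)"
  using assms finite_vert[OF assms(1)] by (auto simp: parcs_middle_graph pverts_middle_graph)

lemma arcE:
  assumes "(v, w) \<in> parcs (middle_graph k)"
  obtains x where "card v = k" "x \<in> {1..2*k+1}" "x \<notin> v" "w = insert x v"
  | x where "card v = Suc k" "x \<in> v" "w = v - {x}"
proof -
  have fin: "finite v" "finite w" using assms finite_vert by (auto simp: parcs_middle_graph)
  have *: "\<exists>x. x \<notin> s \<and> t = insert x s" if "s \<subseteq> t" "card t = Suc (card s)" "finite s" "finite t" for s t :: "nat set"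
  proof -
    have "card (t - s) = 1" using that by (simp add: card_Diff_subset)
    then obtain x where "t - s = {x}" by (auto simp: card_1_singleton_iff)
    then show ?thesis using that(1) by blast
  qed
  consider "v \<subseteq> w" "card v = k" "card w = Suc k" | "w \<subseteq> v" "card w = k" "card v = Suc k"
    using assms by (auto simp: parcs_middle_graph)
  then show thesis
  proof cases
    case 1
    then obtain x where "x \<notin> v" "w = insert x v" using *[of v w] fin by auto
    then show thesis using that(1)[of x] 1 assms by (auto simp: parcs_middle_graph pverts_middle_graph)
  next
    case 2
    then obtain x where x: "x \<notin> w" "v = insert x w" using *[of w v] fin by auto
    then have "x \<in> v" "w = v - {x}" by blast+
    then show thesis using that(2) 2(3) by blast
  qed
qed

lemma card_Compl_vert:
  assumes "v \<in> pverts (middle_graph k)"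
  shows "card ({1..2*k+1} - v) = 2 * k + 1 - card v"
  using assms finite_vert[OF assms] by (simp add: card_Diff_subset pverts_middle_graph)

text \<open>Every vertex of the middle graph has \<open>k + 1\<close> neighbours, so the members of \<open>T\<close> keep at least \<open>k\<close> of
  them, and the two levels of \<open>T\<close> are families as above with \<open>p = q = k\<close>.\<close>

lemma card_ge_if_one_neighbour_missing:
  assumes k: "k \<ge> 1" and T: "T \<subseteq> pverts (middle_graph k)" "T \<noteq> {}"
    and miss: "\<And>v u w. \<lbrakk>v \<in> T; (v, u) \<in> parcs (middle_graph k); (v, w) \<in> parcs (middle_graph k);
       u \<notin> T; w \<notin> T\<rbrakk> \<Longrightarrow> u = w"
  shows "2 * ((2 * k - 1) choose (k - 1)) \<le> card T"
proof -
  let ?V = "pverts (middle_graph k)"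
  have fin: "finite T" using T(1) finite_pverts_middle_graph by (rule finite_subset)
  define A where "A = {a \<in> T. card a = k}"
  define B where "B = {b \<in> T. card b = Suc k}"
  have TAB: "T = A \<union> B" "A \<inter> B = {}" using T(1) by (auto simp: A_def B_def pverts_middle_graph)
  have count: "k \<le> card {x \<in> X. f x \<in> T}"
    if X: "card X = Suc k" "inj_on f X" and v: "v \<in> T" "\<And>x. x \<in> X \<Longrightarrow> (v, f x) \<in> parcs (middle_graph k)"
    for X :: "nat set" and f v
  proof -
    have finX: "finite X" using X(1) card.infinite by fastforce
    have "card {x \<in> X. f x \<notin> T} \<le> 1"
      using finX miss[OF v(1) v(2) v(2)] inj_onD[OF X(2)] by (auto simp: card_le_Suc0_iff_eq)
    moreover have "card X = card {x \<in> X. f x \<in> T} + card {x \<in> X. f x \<notin> T}"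
      by (subst card_Un_disjoint[symmetric]) (use finX in \<open>auto intro!: arg_cong[where f = card]\<close>)
    ultimately show ?thesis using X(1) by simp
  qed
  have up: "k \<le> card {x. x \<notin> a \<and> insert x a \<in> B}" if a: "a \<in> A" for a
  proof -
    have a': "a \<in> T" "a \<in> ?V" "card a = k" using a T(1) by (auto simp: A_def)
    have "k \<le> card {x \<in> {1..2*k+1} - a. insert x a \<in> T}"
      using a' card_Compl_vert[of a k] arc_insert[of a k]
      by (intro count[where v = a]) (auto simp: inj_on_def)
    also have "{x \<in> {1..2*k+1} - a. insert x a \<in> T} = {x. x \<notin> a \<and> insert x a \<in> B}"
      using a' finite_vert[OF a'(2)] T(1) by (auto simp: B_def pverts_middle_graph)
    finally show ?thesis .
  qed
  have down: "k \<le> card {x. x \<in> b \<and> b - {x} \<in> A}" if b: "b \<in> B" for b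
  proof -
    have b': "b \<in> T" "b \<in> ?V" "card b = Suc k" using b T(1) by (auto simp: B_def)
    have "k \<le> card {x \<in> b. b - {x} \<in> T}"
      using b' arc_remove[of b k] by (intro count[where v = b]) (auto simp: inj_on_def)
    also have "{x \<in> b. b - {x} \<in> T} = {x. x \<in> b \<and> b - {x} \<in> A}"
      using b' finite_vert[OF b'(2)] by (auto simp: A_def)
    finally show ?thesis .
  qed
  have "A \<noteq> {}"
  proof
    assume "A = {}"
    then obtain b where "b \<in> B" using T(2) TAB by blast
    then show False using down[of b] k \<open>A = {}\<close> by simp
  qed
  then have "(k + k - 1) choose (k - 1) \<le> card A \<and> (k + k - 1) choose k \<le> card B"
    using fin k up down by (intro card_families_ge_binomial) (auto simp: A_def B_def)
  moreover have "(k + k - 1) choose k = (k + k - 1) choose (k - 1)"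
    using k by (subst binomial_symmetric) auto
  moreover have "card T = card A + card B"
    using TAB fin by (simp add: card_Un_disjoint)
  ultimately show ?thesis by (simp add: mult_2)
qed

section \<open>The robber's side\<close>

text \<open>The middle graph is bipartite and has no 4-cycle: two sets of equal size have at most one common
  neighbour, namely their union or their intersection.  So, seen from a vertex other than the
  cop's, all neighbours but one are out of the cop's reach.\<close>

lemma cop_spoils_at_most_one:
  assumes "v \<noteq> c" and arcs: "(v, u) \<in> parcs (middle_graph k)" "(v, w) \<in> parcs (middle_graph k)"
    and near: "u \<in> closed_nbhd (middle_graph k) c" "w \<in> closed_nbhd (middle_graph k) c"
  shows "u = w"
proof (rule ccontr)
  assume ne: "u \<noteq> w"
  have fin: "finite v" "finite c" if "(c, u) \<in> parcs (middle_graph k)"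
    using that arcs finite_vert by (auto simp: parcs_middle_graph)
  have same: "card u = card w" using arcs by (auto simp: parcs_middle_graph)
  have "u \<noteq> c" "w \<noteq> c"
    using near ne same by (auto simp: closed_nbhd_def parcs_middle_graph)
  then have c: "(c, u) \<in> parcs (middle_graph k)" "(c, w) \<in> parcs (middle_graph k)"
    using near by (auto simp: closed_nbhd_def)
  from arcs(1) show False
  proof (cases rule: arcE)
    case 1
    then obtain y where "w = insert y v" using arcs(2) by (auto elim: arcE)
    moreover have "c \<subseteq> u" "c \<subseteq> w" "card c = card v"
      using c 1 arcs by (auto simp: parcs_middle_graph)
    ultimately have "c \<subseteq> v" using 1 ne by blast
    then show False using \<open>card c = card v\<close> \<open>v \<noteq> c\<close> fin c by (metis card_subset_eq)
  next
    case 2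
    then obtain y where "w = v - {y}" using arcs(2) by (auto elim: arcE)
    moreover have "u \<subseteq> c" "w \<subseteq> c" "card c = card v"
      using c 2 arcs by (auto simp: parcs_middle_graph)
    ultimately have "v \<subseteq> c" using 2 ne by blast
    then show False using \<open>card c = card v\<close> \<open>v \<noteq> c\<close> fin c by (metis card_subset_eq)
  qed
qed

lemma complement_far:
  assumes "k \<ge> 1" "c \<in> pverts (middle_graph k)"
  shows "{1..2*k+1} - c \<in> pverts (middle_graph k)"
    "{1..2*k+1} - c \<notin> closed_nbhd (middle_graph k) c"
proof -
  let ?d = "{1..2*k+1} - c"
  show d: "?d \<in> pverts (middle_graph k)"
    using card_Compl_vert[OF assms(2)] assms(2) by (auto simp: pverts_middle_graph)
  have "c \<noteq> {}" "?d \<noteq> {}"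
    using assms d by (auto simp: pverts_middle_graph)
  then show "?d \<notin> closed_nbhd (middle_graph k) c"
    by (auto simp: closed_nbhd_def parcs_middle_graph)
qed

lemma two_neighbours:
  assumes k: "k \<ge> 1" and v: "v \<in> pverts (middle_graph k)"
  shows "\<exists>u w. u \<noteq> w \<and> (v, u) \<in> parcs (middle_graph k) \<and> (v, w) \<in> parcs (middle_graph k)"
proof -
  have two: "\<exists>x y. x \<in> X \<and> y \<in> X \<and> x \<noteq> y" if "card X = Suc k" for X :: "nat set"
  proof -
    have "finite X" "\<not> card X \<le> Suc 0" using that k card.infinite[of X] by auto
    then show ?thesis by (auto simp: card_le_Suc0_iff_eq)
  qed
  consider "card v = k" | "card v = Suc k" using v by (auto simp: pverts_middle_graph)
  then show ?thesis
  proof cases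
    case 1
    then obtain x y where "x \<in> {1..2*k+1} - v" "y \<in> {1..2*k+1} - v" "x \<noteq> y"
      using two[of "{1..2*k+1} - v"] card_Compl_vert[OF v] by auto
    then show ?thesis using arc_insert[OF v 1] by (metis DiffD2 insertI1 insert_iff)
  next
    case 2
    then obtain x y where "x \<in> v" "y \<in> v" "x \<noteq> y" using two by blast
    then show ?thesis using arc_remove[OF v 2] by (metis DiffE DiffI insertI1 singletonD)
  qed
qed

lemma robber_damages:
  assumes k: "k \<ge> 1"
  shows "\<exists>\<rho>. robber_strategy (middle_graph k) \<rho> \<and> (\<forall>\<sigma>. cop_strategy (middle_graph k) \<sigma> \<longrightarrow>
      2 * ((2 * k - 1) choose (k - 1)) \<le> card (damaged (play \<sigma> \<rho>)))"
proof -
  let ?G = "middle_graph k"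
  have ne: "{1..k} \<in> pverts ?G" by (simp add: pverts_middle_graph)
  obtain \<rho> where \<rho>: "robber_strategy ?G \<rho>"
    and fair: "\<And>\<sigma>. cop_strategy ?G \<sigma> \<Longrightarrow> \<exists>T \<subseteq> damaged (play \<sigma> \<rho>). T \<noteq> {} \<and> T \<subseteq> pverts ?G \<and>
           (\<forall>v\<in>T. \<forall>u w. (v, u) \<in> parcs ?G \<longrightarrow> (v, w) \<in> parcs ?G \<longrightarrow> u \<notin> T \<longrightarrow> w \<notin> T \<longrightarrow> u = w)"
  proof (rule robber_fair_damage[OF pair_graph_middle_graph])
    show "pverts ?G \<noteq> {}" using ne by blast
    show "\<exists>v\<in>pverts ?G. v \<notin> closed_nbhd ?G c" if "c \<in> pverts ?G" for c
      using complement_far[OF k that] by blast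
    show "u = w" if "v \<noteq> c" "(v, u) \<in> parcs ?G" "(v, w) \<in> parcs ?G"
      "u \<in> closed_nbhd ?G c" "w \<in> closed_nbhd ?G c" for c v u w
      by (rule cop_spoils_at_most_one[OF that])
  qed (rule two_neighbours[OF k], assumption, rule that)
  have "2 * ((2 * k - 1) choose (k - 1)) \<le> card (damaged (play \<sigma> \<rho>))"
    if \<sigma>: "cop_strategy ?G \<sigma>" for \<sigma>
  proof -
    obtain T where T: "T \<subseteq> damaged (play \<sigma> \<rho>)" "T \<noteq> {}" "T \<subseteq> pverts ?G"
      "\<And>v u w. \<lbrakk>v \<in> T; (v, u) \<in> parcs ?G; (v, w) \<in> parcs ?G; u \<notin> T; w \<notin> T\<rbrakk> \<Longrightarrow> u = w"
      using fair[OF \<sigma>] by metis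
    have "damaged (play \<sigma> \<rho>) \<subseteq> pverts ?G"
      unfolding damaged_def using play_in_verts(2)[OF pair_graph_middle_graph \<sigma> \<rho>] by blast
    with T(1) have "card T \<le> card (damaged (play \<sigma> \<rho>))"
      using finite_pverts_middle_graph by (meson card_mono finite_subset)
    moreover have "2 * ((2 * k - 1) choose (k - 1)) \<le> card T"
      by (rule card_ge_if_one_neighbour_missing[OF k T(3,2)]) (erule (4) T(4))
    ultimately show ?thesis by (rule le_trans[rotated])
  qed
  then show ?thesis using \<rho> by blast
qed

section \<open>The cop's side\<close>

text \<open>The cop copies the robber's step, unless the robber has changed his set at an element where it
  differs from the cop's.  Copying is impossible then, but since the two sets have equal size,
  they also differ the other way round, and changing the cop's set at such an element keeps the sizes
  equal.\<close>

lemma cop_shadows: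
  assumes V: "c \<in> pverts (middle_graph k)" "r \<in> pverts (middle_graph k)" and eq: "card c = card r"
    and step: "r' \<in> closed_nbhd (middle_graph k) r"
  shows "\<exists>c' \<in> closed_nbhd (middle_graph k) c. card c' = card r' \<and> c' - r' \<subseteq> c - r \<and> r' - c' \<subseteq> r - c"
proof (cases "r' = r")
  case True
  then show ?thesis using eq by (intro bexI[of _ c]) (auto simp: closed_nbhd_def)
next
  case False
  let ?G = "middle_graph k"
  have fin: "finite c" "finite r" using V finite_vert by auto
  have diff: "card (c - r) = card (r - c)"
    using fin eq by (metis card_le_sym_Diff le_antisym order_refl)
  have "(r, r') \<in> parcs ?G" using step False by (simp add: closed_nbhd_def)
  then show ?thesis
  proof (cases rule: arcE)
    case (1 x)
    obtain e where e: "e \<notin> c" "e \<in> insert x r" "x \<notin> c \<longrightarrow> e = x"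
    proof (cases "x \<in> c")
      case True
      then have "card (c - r) \<noteq> 0" using 1 fin by auto
      then have "r - c \<noteq> {}" using diff by (metis card.empty)
      then show ?thesis using that True by blast
    qed (use that in blast)
    have "e \<in> {1..2*k+1}" using e(2) 1 V(2) by (auto simp: pverts_middle_graph)
    then have "insert e c \<in> closed_nbhd ?G c"
      using arc_insert[OF V(1), of e] e(1) 1 eq by (simp add: closed_nbhd_def)
    moreover have "card (insert e c) = card r'" using e(1) 1 eq fin by simp
    moreover have "insert e c - r' \<subseteq> c - r" "r' - insert e c \<subseteq> r - c" using e 1 by auto
    ultimately show ?thesis by blast
  next
    case (2 x)
    obtain d where d: "d \<in> c" "d \<notin> r - {x}" "x \<in> c \<longrightarrow> d = x"
    proof (cases "x \<in> c")
      case False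
      then have "card (r - c) \<noteq> 0" using 2 fin by auto
      then have "c - r \<noteq> {}" using diff by (metis card.empty)
      then show ?thesis using that False by blast
    qed (use that in blast)
    have "c - {d} \<in> closed_nbhd ?G c"
      using arc_remove[OF V(1) _ d(1)] 2 eq by (simp add: closed_nbhd_def)
    moreover have "card (c - {d}) = card r'" using d(1) 2 eq fin by simp
    moreover have "c - {d} - r' \<subseteq> c - r" "r' - (c - {d}) \<subseteq> r - c" using d 2 by auto
    ultimately show ?thesis by blast
  qed
qed

text \<open>Removing \<open>a\<close> leaves a set of size \<open>k - 1\<close> or \<open>k\<close> among the remaining \<open>2 * k - 1\<close> elements.\<close>

lemma card_vertices_separating:
  assumes k: "k \<ge> 1" and ab: "a \<noteq> b" "a \<in> {1..2*k+1}" "b \<in> {1..2*k+1}"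
  shows "card {v \<in> pverts (middle_graph k). a \<in> v \<and> b \<notin> v} \<le> 2 * ((2 * k - 1) choose (k - 1))"
proof -
  let ?U = "{1..2*k+1} - {a, b}"
  let ?S = "\<lambda>j. {X. X \<subseteq> ?U \<and> card X = j}"
  have U: "card ?U = 2 * k - 1" using ab by (simp add: card_Diff_subset)
  have fin: "finite (?S (k - 1) \<union> ?S k)"
    by (rule finite_subset[of _ "Pow ?U"]) auto
  have "{v \<in> pverts (middle_graph k). a \<in> v \<and> b \<notin> v} \<subseteq> insert a ` (?S (k - 1) \<union> ?S k)"
  proof
    fix v assume "v \<in> {v \<in> pverts (middle_graph k). a \<in> v \<and> b \<notin> v}"
    then have v: "v \<in> pverts (middle_graph k)" "a \<in> v" "b \<notin> v" by auto
    then have "v - {a} \<in> ?S (k - 1) \<union> ?S k" by (auto simp: pverts_middle_graph)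
    moreover have "v = insert a (v - {a})" using v by blast
    ultimately show "v \<in> insert a ` (?S (k - 1) \<union> ?S k)" by blast
  qed
  then have "card {v \<in> pverts (middle_graph k). a \<in> v \<and> b \<notin> v} \<le> card (?S (k - 1) \<union> ?S k)"
    using fin by (meson card_image_le card_mono finite_imageI le_trans)
  also have "\<dots> \<le> card (?S (k - 1)) + card (?S k)" by (rule card_Un_le)
  also have "\<dots> = ((2 * k - 1) choose (k - 1)) + ((2 * k - 1) choose k)"
    using U by (simp add: n_subsets)
  also have "(2 * k - 1) choose k = (2 * k - 1) choose (k - 1)"
    using k by (subst binomial_symmetric) auto
  finally show ?thesis by simp
qed

text \<open>Once the cop has brought his set \<open>c\<close> to the size of the robber's set \<open>r\<close>, he shadows him.  The
  differences \<open>r - c\<close> and \<open>c - r\<close>, taken after the cop's move, never grow, so that those at the time of the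
  last damage separate all damaged vertices: an element \<open>a\<close> of the former lies in each of them, and an
  element \<open>b\<close> of the latter in none.\<close>

lemma cop_protects:
  assumes k: "k \<ge> 1"
  shows "\<exists>\<sigma>. cop_strategy (middle_graph k) \<sigma> \<and> (\<forall>\<rho>. robber_strategy (middle_graph k) \<rho> \<longrightarrow>
      card (damaged (play \<sigma> \<rho>)) \<le> 2 * ((2 * k - 1) choose (k - 1)))"
proof -
  let ?G = "middle_graph k"
  \<comment> \<open>The cop needs the robber's last two positions, to see which step to copy; before there are two
    rounds of history he merely matches the size of the robber's set.\<close>
  define good where "good h c' \<longleftrightarrow> c' \<in> closed_nbhd ?G (fst (last h)) \<and> card c' = card (snd (last h)) \<and>
    (butlast h \<noteq> [] \<longrightarrow> c' - snd (last h) \<subseteq> fst (last h) - snd (last (butlast h)) \<and>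
       snd (last h) - c' \<subseteq> snd (last (butlast h)) - fst (last h))" for h and c' :: "nat set"
  define \<sigma> where "\<sigma> h = (if h = [] then {1..k} else if \<exists>c'. good h c' then SOME c'. good h c'
    else fst (last h))" for h :: "(nat set \<times> nat set) list"
  have good: "good h (\<sigma> h)" if "h \<noteq> []" "good h c'" for h c'
    using that someI[of "good h"] by (auto simp: \<sigma>_def)
  have start: "{1..k} \<in> pverts ?G" by (simp add: pverts_middle_graph)
  have \<sigma>: "cop_strategy ?G \<sigma>"
    unfolding cop_strategy_def
  proof (intro conjI allI impI)
    fix h :: "(nat set \<times> nat set) list" assume h: "h \<noteq> []"
    show "\<sigma> h \<in> closed_nbhd ?G (fst (last h))"
    proof (cases "\<exists>c'. good h c'")
      case True
      then show ?thesis using good[OF h] by (auto simp: good_def)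
    next
      case False
      then have "\<sigma> h = fst (last h)" unfolding \<sigma>_def if_not_P[OF h] by (rule if_not_P)
      then show ?thesis by (simp add: closed_nbhd_def)
    qed
  qed (use start in \<open>simp add: \<sigma>_def\<close>)
  have "card (damaged (play \<sigma> \<rho>)) \<le> 2 * ((2 * k - 1) choose (k - 1))"
    if \<rho>: "robber_strategy ?G \<rho>" for \<rho>
  proof -
    let ?p = "play \<sigma> \<rho>"
    define r where "r n = snd (?p n)" for n
    define c where "c n = fst (?p n)" for n
    have V: "c n \<in> pverts ?G" "r n \<in> pverts ?G" for n
      using play_in_verts[OF pair_graph_middle_graph \<sigma> \<rho>] by (simp_all add: r_def c_def)
    have fin: "finite (c n)" "finite (r n)" for n using V finite_vert by auto
    have rm: "r (Suc n) \<in> closed_nbhd ?G (r n)" for n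
      using robber_moves[OF \<rho>] by (simp add: r_def)
    have hist: "c (Suc n) = \<sigma> (history \<sigma> \<rho> (Suc n))" "last (history \<sigma> \<rho> (Suc n)) = (c n, r n)"
      "butlast (history \<sigma> \<rho> (Suc n)) = history \<sigma> \<rho> n" for n
      unfolding c_def r_def last_history
      by (rule play_step(1), rule prod.collapse[symmetric], simp add: Let_def)
    have shadow: "good (history \<sigma> \<rho> (Suc n)) (c (Suc n))" for n
    proof (induction n)
      case 0
      have c0: "c 0 = {1..k}" by (simp add: c_def play_step(1) \<sigma>_def)
      have "\<exists>c' \<in> closed_nbhd ?G {1..k}. card c' = card (r 0)"
      proof (cases "card (r 0) = k")
        case True
        then show ?thesis by (auto simp: closed_nbhd_def)
      next
        case False
        then have "card (r 0) = Suc k" using V(2)[of 0] by (auto simp: pverts_middle_graph)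
        moreover have "({1..k}, insert (Suc k) {1..k}) \<in> parcs ?G"
          using start by (intro arc_insert) auto
        ultimately show ?thesis by (intro bexI[of _ "insert (Suc k) {1..k}"]) (auto simp: closed_nbhd_def)
      qed
      then obtain c' where "c' \<in> closed_nbhd ?G (c 0)" "card c' = card (r 0)"
        unfolding c0 by blast
      then have "good (history \<sigma> \<rho> (Suc 0)) c'"
        unfolding good_def hist by simp
      then show ?case using good[OF history_Suc_not_Nil] unfolding hist(1) by blast
    next
      case (Suc n)
      then have "card (c (Suc n)) = card (r n)" by (simp only: good_def hist snd_conv)
      then obtain c' where "c' \<in> closed_nbhd ?G (c (Suc n))" "card c' = card (r (Suc n))"
        "c' - r (Suc n) \<subseteq> c (Suc n) - r n" "r (Suc n) - c' \<subseteq> r n - c (Suc n)"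
        using cop_shadows[OF V(1) V(2) _ rm] by blast
      then have "good (history \<sigma> \<rho> (Suc (Suc n))) c'"
        unfolding good_def hist by simp
      then show ?case using good[OF history_Suc_not_Nil] unfolding hist(1)[of "Suc n"] by blast
    qed
    define D where "D n = c (Suc n) - r n" for n
    define E where "E n = r n - c (Suc n)" for n
    have size: "card (c (Suc n)) = card (r n)" for n
      using shadow[of n] by (simp only: good_def hist snd_conv)
    have "D (Suc n) \<subseteq> D n \<and> E (Suc n) \<subseteq> E n" for n
      using shadow[of "Suc n"] history_Suc_not_Nil[of \<sigma> \<rho> n]
      unfolding good_def hist fst_conv snd_conv D_def E_def by blast
    then have anti: "D m \<subseteq> D n" "E m \<subseteq> E n" if "n \<le> m" for m n
      using that lift_Suc_antimono_le[of D n m] lift_Suc_antimono_le[of E n m] by simp_all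
    define I where "I = {i. \<forall>j\<le>Suc i. \<not> caught ?p j}"
    have dam: "damaged ?p = r ` I" by (auto simp: damaged_def I_def r_def)
    have "finite (r ` I)"
      using V(2) finite_pverts_middle_graph by (meson finite_subset image_subsetI)
    then obtain J where J: "J \<subseteq> I" "finite J" "r ` I = r ` J"
      by (metis finite_subset_image order_refl)
    show ?thesis
    proof (cases "J = {}")
      case True
      then show ?thesis using dam J by simp
    next
      case False
      define m where "m = Max J"
      have m: "m \<in> I" "\<And>j. j \<in> J \<Longrightarrow> j \<le> m" using J(1) Max_in[OF J(2) False] Max_ge[OF J(2)] by (auto simp: m_def)
      have "c (Suc m) \<noteq> r m" using m(1) by (auto simp: I_def caught_def c_def r_def)
      then have "D m \<noteq> {}" "E m \<noteq> {}"
        using size[of m] fin card_subset_eq[of "c (Suc m)" "r m"] card_subset_eq[of "r m" "c (Suc m)"]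
        unfolding D_def E_def by auto
      then obtain a b where ab: "a \<in> E m" "b \<in> D m" by blast
      then have "r ` J \<subseteq> {v \<in> pverts ?G. a \<in> v \<and> b \<notin> v}"
        using m(2) anti V(2) unfolding D_def E_def by blast
      then have "card (r ` J) \<le> card {v \<in> pverts ?G. a \<in> v \<and> b \<notin> v}"
        using finite_pverts_middle_graph[of k] by (intro card_mono) auto
      also have "\<dots> \<le> 2 * ((2 * k - 1) choose (k - 1))"
        using ab V(1)[of "Suc m"] V(2)[of m]
        by (intro card_vertices_separating[OF k]) (auto simp: D_def E_def pverts_middle_graph)
      finally show ?thesis using dam J by simp
    qed
  qed
  then show ?thesis using \<sigma> by blast
qed

section \<open>The damage number\<close>

theorem theorem1p3:
  fixes k :: nat
  assumes "k \<ge> 2"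
  shows "dmg (middle_graph k) = 2 * ((2 * k - 1) choose (k - 1))"
  unfolding dmg_def
proof (rule Max_eqI)
  have k: "k \<ge> 1" using assms by simp
  let ?G = "middle_graph k"
  have "{1..k} \<in> pverts ?G" by (simp add: pverts_middle_graph)
  then show "finite {d. \<exists>\<rho>. robber_strategy ?G \<rho> \<and>
      (\<forall>\<sigma>. cop_strategy ?G \<sigma> \<longrightarrow> d \<le> card (damaged (play \<sigma> \<rho>)))}"
    using dmg_set_wf(1)[OF pair_graph_middle_graph] by blast
  show "2 * ((2 * k - 1) choose (k - 1)) \<in> {d. \<exists>\<rho>. robber_strategy ?G \<rho> \<and>
      (\<forall>\<sigma>. cop_strategy ?G \<sigma> \<longrightarrow> d \<le> card (damaged (play \<sigma> \<rho>)))}"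
    using robber_damages[OF k] by simp
  fix d
  assume "d \<in> {d. \<exists>\<rho>. robber_strategy ?G \<rho> \<and>
      (\<forall>\<sigma>. cop_strategy ?G \<sigma> \<longrightarrow> d \<le> card (damaged (play \<sigma> \<rho>)))}"
  then show "d \<le> 2 * ((2 * k - 1) choose (k - 1))"
    using cop_protects[OF k] by (blast intro: le_trans)
qed

end
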